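(* Let $\Sigma,\Sigma'$ be finite alphabets with at least two elements, let $C=C(\{C_s\}_{s\in S})\subseteq\Sigma^n$ be a lifted code with $|C_s|=|\Sigma'|$ for all $s\in S$, and let $L\subseteq\Sigma'^S$ be its line code (each $C_s$ being identified with $\Sigma'$ by some bijection). Then: (i) $r(C)=\frac{\gamma\log|\Sigma'|}{\log|\Sigma|}\,r(L)$, where $\gamma:=\frac{|S|}{n}\in\left[\frac{D_{\min}}{k_{\max}},\frac{D_{\max}}{k_{\min}}\right]$. (ii) $\frac{D_{\min}\tilde k}{D_{\max}k_{\max}}\,\delta(L)\le\delta(C)\le\frac{D_{\max}k_{\max}}{D_{\min}k_{\min}}\,\delta(L)$.
   Context: $[n]=\{1,\dots,n\}$; $\mathrm{dist}$ is normalized Hamming distance; for a code $D\subseteq\Sigma^n$, $\delta(D)=\min\{\mathrm{dist}(f,g):f\ne g\in D\}$ ($+\infty$ if $|D|=1$) and $r(D)=\log_{|\Sigma^n|}|D|$. Codes are nonempty. **Lifted code.** $S$ is a collection of subsets of $[n]$ with $\bigcup_{s\in S}s=[n]$ and $C_s\subseteq\Sigma^s$ is a code for each $s\in S$; $C(\{C_s\}_{s\in S})=\{g\in\Sigma^n:g|_s\in C_s\ \forall s\in S\}$ (assumed nonempty). **Line code.** $L=\{(f_s)_{s\in S}\in\prod_{s\in S}C_s:f_s|_{s\cap s'}=f_{s'}|_{s\cap s'}\ \forall s,s'\in S\}$, viewed inside $\Sigma'^S$ via the bijections $C_s\cong\Sigma'$. **Constants.** $k_{\min}=\min_{s\in S}|s|$,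 $k_{\max}=\max_{s\in S}|s|$, $D_{\min}=\min_{i\in[n]}\#\{s\in S:i\in s\}$, $D_{\max}=\max_{i\in[n]}\#\{s\in S:i\in s\}$, $\tilde k=\min_{s\in S}(\delta(C_s)|s|)$. *)

theory Defs
  imports Complex_Main "HOL-Library.FuncSet" "HOL-Library.Extended_Real"
begin

(* Words over the alphabet A with positions in a finite index set I are the extensional
   functions in I \<rightarrow>\<^sub>E A, so that equality of words is equality of functions.  The index set
   is {1..n} for C, a subset s of {1..n} for the local codes C_s, and the set system S
   itself for the line code. *)

definition hdist :: "'i set \<Rightarrow> ('i \<Rightarrow> 'a) \<Rightarrow> ('i \<Rightarrow> 'a) \<Rightarrow> real" where
  "hdist I f g = real (card {i \<in> I. f i \<noteq> g i}) / real (card I)"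

(* Meaningful for finite nonempty D only: Min is unspecified on the empty set, which is the
   set of distances for D = {}. *)
definition code_dist :: "'i set \<Rightarrow> ('i \<Rightarrow> 'a) set \<Rightarrow> ereal" where
  "code_dist I D =
     (if card D = 1 then \<infinity>
      else Min {ereal (hdist I f g) | f g. f \<in> D \<and> g \<in> D \<and> f \<noteq> g})"

definition code_rate :: "'i set \<Rightarrow> 'a set \<Rightarrow> ('i \<Rightarrow> 'a) set \<Rightarrow> real" where
  "code_rate I A D = log (real (card (I \<rightarrow>\<^sub>E A))) (real (card D))"

definition lifted_code ::
  "nat \<Rightarrow> 'a set \<Rightarrow> nat set set \<Rightarrow> (nat set \<Rightarrow> (nat \<Rightarrow> 'a) set) \<Rightarrow> (nat \<Rightarrow> 'a) set" where
  "lifted_code n A S Cs = {g \<in> {1..n} \<rightarrow>\<^sub>E A. \<forall>s\<in>S. restrict g s \<in> Cs s}"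

definition line_families ::
  "nat set set \<Rightarrow> (nat set \<Rightarrow> (nat \<Rightarrow> 'a) set) \<Rightarrow> (nat set \<Rightarrow> nat \<Rightarrow> 'a) set" where
  "line_families S Cs =
     {f \<in> Pi\<^sub>E S Cs. \<forall>s\<in>S. \<forall>s'\<in>S. restrict (f s) (s \<inter> s') = restrict (f s') (s \<inter> s')}"

(* \<phi> s identifies the local code C_s with the alphabet of the line code. *)
definition line_code ::
  "nat set set \<Rightarrow> (nat set \<Rightarrow> (nat \<Rightarrow> 'a) set) \<Rightarrow> (nat set \<Rightarrow> (nat \<Rightarrow> 'a) \<Rightarrow> 'b)
     \<Rightarrow> (nat set \<Rightarrow> 'b) set" where
  "line_code S Cs \<phi> = (\<lambda>f. \<lambda>s\<in>S. \<phi> s (f s)) ` line_families S Cs"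

definition k_min :: "nat set set \<Rightarrow> nat" where
  "k_min S = Min (card ` S)"

definition k_max :: "nat set set \<Rightarrow> nat" where
  "k_max S = Max (card ` S)"

definition D_min :: "nat \<Rightarrow> nat set set \<Rightarrow> nat" where
  "D_min n S = Min ((\<lambda>i. card {s \<in> S. i \<in> s}) ` {1..n})"

definition D_max :: "nat \<Rightarrow> nat set set \<Rightarrow> nat" where
  "D_max n S = Max ((\<lambda>i. card {s \<in> S. i \<in> s}) ` {1..n})"

definition k_tilde :: "nat set set \<Rightarrow> (nat set \<Rightarrow> (nat \<Rightarrow> 'a) set) \<Rightarrow> ereal" where
  "k_tilde S Cs = Min ((\<lambda>s. code_dist s (Cs s) * ereal (real (card s))) ` S)"

end

theory Submission
  imports Defs
begin

text \<open>
  Restricting a word of \<open>C\<close> to the sets \<open>s \<in> S\<close> is a bijection from \<open>C\<close> to \<open>L\<close>, which gives the rates.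
  Two words that differ exactly on \<open>T\<close> have images that differ exactly on \<open>U = {s \<in> S. s \<inter> T \<noteq> {}}\<close>.
  Counting the incidences between \<open>T\<close> and \<open>U\<close> in two ways yields \<open>D_min |T| \<le> k_max |U|\<close> and,
  since every \<open>s \<in> U\<close> meets \<open>T\<close> in at least \<open>k_tilde\<close> points, \<open>k_tilde |U| \<le> D_max |T|\<close>.
  The same count for \<open>T = {1..n}\<close> and \<open>U = S\<close> bounds \<open>\<gamma>\<close>, which converts between the two
  normalisations of the distance.
\<close>

section \<open>Incidences between points and sets of \<open>S\<close>\<close>

lemma sum_card_Int_eq_sum_degree:
  assumes "finite S" "finite T"
  shows "(\<Sum>s\<in>S. card (s \<inter> T)) = (\<Sum>i\<in>T. card {s \<in> S. i \<in> s})"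
proof -
  have "(\<Sum>s\<in>S. card {i \<in> T. i \<in> s}) = (\<Sum>i\<in>T. card {s \<in> S. i \<in> s})"
    using assms by (intro sum_multicount_gen) auto
  moreover have "{i \<in> T. i \<in> s} = s \<inter> T" for s
    by auto
  ultimately show ?thesis
    by simp
qed

lemma degree_bounds:
  assumes "i \<in> {1..n}"
  shows "D_min n S \<le> card {s \<in> S. i \<in> s}" "card {s \<in> S. i \<in> s} \<le> D_max n S"
  using assms by (auto simp: D_min_def D_max_def intro!: Min_le Max_ge)

lemma card_bounds:
  assumes "finite S" "s \<in> S"
  shows "k_min S \<le> card s" "card s \<le> k_max S"
  using assms by (auto simp: k_min_def k_max_def)

text \<open>Each point of \<open>T\<close> lies in at least \<open>D_min n S\<close> sets of
  \<open>S\<close>, and all of these belong to \<open>U\<close>; each set in \<open>U\<close> has at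
  most \<open>k_max S\<close> points. Keeping \<open>T\<close> and \<open>U\<close> general lets one
  count serve both the whole system and a set of differing positions.\<close>

lemma D_min_mult_card_le:
  assumes "finite S" "\<And>s. s \<in> S \<Longrightarrow> finite s"
    and "T \<subseteq> {1..n}" "U \<subseteq> S" "\<And>s. s \<in> S \<Longrightarrow> s \<inter> T \<noteq> {} \<Longrightarrow> s \<in> U"
  shows "D_min n S * card T \<le> k_max S * card U"
proof -
  have T: "finite T"
    using assms(3) finite_subset by blast
  have disjoint: "s \<inter> T = {}" if "s \<in> S - U" for s
    using assms(5) that by blast
  have "D_min n S * card T = (\<Sum>i\<in>T. D_min n S)"
    by simp
  also have "\<dots> \<le> (\<Sum>i\<in>T. card {s \<in> S. i \<in> s})"
    using degree_bounds(1) assms(3) by (intro sum_mono) blast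
  also have "\<dots> = (\<Sum>s\<in>S. card (s \<inter> T))"
    using sum_card_Int_eq_sum_degree[OF assms(1) T] by simp
  also have "\<dots> = (\<Sum>s\<in>U. card (s \<inter> T))"
    using assms(1,4) disjoint by (intro sum.mono_neutral_right) auto
  also have "\<dots> \<le> (\<Sum>s\<in>U. k_max S)"
  proof (rule sum_mono)
    fix s assume "s \<in> U"
    then have "s \<in> S"
      using assms(4) by blast
    then have "card (s \<inter> T) \<le> card s"
      using assms(2) by (intro card_mono) auto
    also have "\<dots> \<le> k_max S"
      using card_bounds(2)[OF assms(1) \<open>s \<in> S\<close>] .
    finally show "card (s \<inter> T) \<le> k_max S" .
  qed
  finally show ?thesis
    by (simp add: mult.commute)
qed

text \<open>The count in the opposite direction, with a lower bound on the intersections in place of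
  one on the degrees. The bound \<open>k\<close> is real so that it can be either
  \<open>k_min S\<close> or the value of \<open>k_tilde\<close>.\<close>

lemma mult_card_le_D_max:
  fixes k :: real
  assumes "finite S" "T \<subseteq> {1..n}" "U \<subseteq> S" "\<And>s. s \<in> U \<Longrightarrow> k \<le> real (card (s \<inter> T))"
  shows "k * real (card U) \<le> real (D_max n S) * real (card T)"
proof -
  have T: "finite T"
    using assms(2) finite_subset by blast
  have "k * real (card U) = (\<Sum>s\<in>U. k)"
    by simp
  also have "\<dots> \<le> (\<Sum>s\<in>U. real (card (s \<inter> T)))"
    using assms(4) by (rule sum_mono)
  also have "\<dots> \<le> (\<Sum>s\<in>S. real (card (s \<inter> T)))"
    using assms(1,3) by (intro sum_mono2) auto
  also have "\<dots> = (\<Sum>i\<in>T. real (card {s \<in> S. i \<in> s}))"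
    using arg_cong[OF sum_card_Int_eq_sum_degree[OF assms(1) T], of real] by simp
  also have "\<dots> \<le> (\<Sum>i\<in>T. real (D_max n S))"
    using degree_bounds(2) assms(2) by (intro sum_mono of_nat_mono) blast
  finally show ?thesis
    by (simp add: mult.commute)
qed

section \<open>Minimum distances as attained real values\<close>

lemma hdist_nonneg: "0 \<le> hdist I f g"
  by (simp add: hdist_def)

lemma finite_hdist_set:
  assumes "finite D"
  shows "finite {ereal (hdist I f g) | f g. f \<in> D \<and> g \<in> D \<and> f \<noteq> g}"
  by (rule finite_subset[of _ "(\<lambda>(f, g). ereal (hdist I f g)) ` (D \<times> D)"]) (use assms in auto)

lemma code_dist_le:
  assumes "finite D" "f \<in> D" "g \<in> D" "f \<noteq> g"
  shows "code_dist I D \<le> ereal (hdist I f g)"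
proof -
  have "card D \<noteq> 1"
    using assms(2-4) by (auto simp: card_1_singleton_iff)
  then show ?thesis
    using finite_hdist_set[OF assms(1)] assms(2-4) by (auto simp: code_dist_def intro!: Min_le)
qed

lemma code_dist_attained:
  assumes "2 \<le> card D"
  obtains f g where "f \<in> D" "g \<in> D" "f \<noteq> g" "code_dist I D = ereal (hdist I f g)"
proof -
  let ?M = "{ereal (hdist I f g) | f g. f \<in> D \<and> g \<in> D \<and> f \<noteq> g}"
  have "finite D"
    using assms by (auto intro: card_ge_0_finite)
  moreover obtain f g where "f \<in> D" "g \<in> D" "f \<noteq> g"
    using assms card_le_Suc0_iff_eq[OF \<open>finite D\<close>] by (auto simp: numeral_2_eq_2)
  then have "?M \<noteq> {}"
    by blast
  ultimately have "Min ?M \<in> ?M"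
    using finite_hdist_set by (intro Min_in)
  then show ?thesis
    using that assms by (auto simp: code_dist_def)
qed

text \<open>With two words in every local code, no factor in the minimum is infinite, so
  \<open>k_tilde\<close> is a real number. Multiplying by \<open>card s\<close> undoes the
  normalisation of \<open>hdist\<close>, so this number bounds the plain count of differing
  positions.\<close>

lemma k_tilde_real:
  assumes "finite S" "S \<noteq> {}" "\<And>s. s \<in> S \<Longrightarrow> finite s \<and> s \<noteq> {} \<and> 2 \<le> card (Cs s)"
  obtains k where "k_tilde S Cs = ereal k" "0 \<le> k"
    "\<forall>s\<in>S. \<forall>f\<in>Cs s. \<forall>g\<in>Cs s. f \<noteq> g \<longrightarrow> k \<le> real (card {i \<in> s. f i \<noteq> g i})"
proof -
  have "k_tilde S Cs \<in> (\<lambda>s. code_dist s (Cs s) * ereal (real (card s))) ` S"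
    unfolding k_tilde_def using assms(1,2) by (intro Min_in) auto
  then obtain s where s: "s \<in> S" "k_tilde S Cs = code_dist s (Cs s) * ereal (real (card s))"
    by blast
  have "2 \<le> card (Cs s)"
    using assms(3) s(1) by blast
  then obtain f g where "f \<in> Cs s" "g \<in> Cs s" "f \<noteq> g" "code_dist s (Cs s) = ereal (hdist s f g)"
    by (rule code_dist_attained)
  with s(2) have k: "k_tilde S Cs = ereal (hdist s f g * real (card s))"
    by simp
  have "hdist s f g * real (card s) \<le> real (card {i \<in> t. u i \<noteq> v i})"
    if t: "t \<in> S" "u \<in> Cs t" "v \<in> Cs t" "u \<noteq> v" for t u v
  proof -
    have fin: "finite (Cs t)" "card t \<noteq> 0"
      using assms(3)[OF t(1)] by (auto intro: card_ge_0_finite)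
    have "k_tilde S Cs \<le> code_dist t (Cs t) * ereal (real (card t))"
      unfolding k_tilde_def using assms(1) t(1) by (intro Min_le) auto
    also have "\<dots> \<le> ereal (hdist t u v) * ereal (real (card t))"
      using code_dist_le[OF fin(1) t(2-4)] by (intro ereal_mult_right_mono) auto
    also have "\<dots> = ereal (real (card {i \<in> t. u i \<noteq> v i}))"
      using fin(2) by (simp add: hdist_def)
    finally show ?thesis
      using k by simp
  qed
  moreover have "0 \<le> hdist s f g * real (card s)"
    by (simp add: hdist_nonneg)
  ultimately show ?thesis
    using k that by blast
qed

text \<open>A word is recovered from its restrictions because \<open>S\<close> covers
  \<open>{1..n}\<close>. Conversely, local words that agree on overlaps glue to a global
  word.\<close>

lemma bij_betw_lifted_line_families:
  assumes "\<Union>S = {1..n}" "\<And>s. s \<in> S \<Longrightarrow> Cs s \<subseteq> s \<rightarrow>\<^sub>E A"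
  shows "bij_betw (\<lambda>g. \<lambda>s\<in>S. restrict g s) (lifted_code n A S Cs) (line_families S Cs)"
proof (rule bij_betw_imageI)
  show "inj_on (\<lambda>g. \<lambda>s\<in>S. restrict g s) (lifted_code n A S Cs)"
  proof (rule inj_onI)
    fix g h
    assume gh: "g \<in> lifted_code n A S Cs" "h \<in> lifted_code n A S Cs"
      and eq: "(\<lambda>s\<in>S. restrict g s) = (\<lambda>s\<in>S. restrict h s)"
    show "g = h"
    proof (rule PiE_ext)
      show "g \<in> {1..n} \<rightarrow>\<^sub>E A" "h \<in> {1..n} \<rightarrow>\<^sub>E A"
        using gh by (auto simp: lifted_code_def)
      fix i assume "i \<in> {1..n}"
      then obtain s where "s \<in> S" "i \<in> s"
        using assms(1) by blast
      then show "g i = h i"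
        using fun_cong[OF fun_cong[OF eq, of s], of i] by simp
    qed
  qed
next
  show "(\<lambda>g. \<lambda>s\<in>S. restrict g s) ` lifted_code n A S Cs = line_families S Cs"
  proof (intro equalityI subsetI)
    fix f assume "f \<in> (\<lambda>g. \<lambda>s\<in>S. restrict g s) ` lifted_code n A S Cs"
    then show "f \<in> line_families S Cs"
      by (auto simp: lifted_code_def line_families_def Int_commute Int_left_commute)
  next
    fix f assume f: "f \<in> line_families S Cs"
    have fC: "f s \<in> Cs s" if "s \<in> S" for s
      using f that by (auto simp: line_families_def)
    \<comment> \<open>The choice of a set containing \<open>i\<close> is immaterial: compatibility
      on overlaps gives the same value for all of them.\<close>
    define g where "g = (\<lambda>i\<in>{1..n}. f (SOME s. s \<in> S \<and> i \<in> s) i)"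
    have g: "g i = f s i" if s: "s \<in> S" "i \<in> s" for s i
    proof -
      let ?t = "SOME s. s \<in> S \<and> i \<in> s"
      have t: "?t \<in> S \<and> i \<in> ?t"
        using s by (intro someI[of "\<lambda>s. s \<in> S \<and> i \<in> s"]) auto
      then have "restrict (f ?t) (?t \<inter> s) = restrict (f s) (?t \<inter> s)"
        using f s by (auto simp: line_families_def)
      from fun_cong[OF this, of i] have "f ?t i = f s i"
        using t s by simp
      moreover have "i \<in> {1..n}"
        using s assms(1) by blast
      ultimately show ?thesis
        by (simp add: g_def)
    qed
    have restr: "restrict g s = f s" if s: "s \<in> S" for s
    proof (rule extensionalityI)
      show "restrict g s \<in> extensional s" "f s \<in> extensional s"
        using assms(2)[OF s] fC[OF s] by (auto simp: PiE_def)
    qed (use g s in simp)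
    have "g \<in> {1..n} \<rightarrow>\<^sub>E A"
    proof (rule PiE_I)
      fix i assume "i \<in> {1..n}"
      then obtain s where "s \<in> S" "i \<in> s"
        using assms(1) by blast
      then show "g i \<in> A"
        using g fC assms(2) by fastforce
    qed (auto simp: g_def)
    then have "g \<in> lifted_code n A S Cs"
      using restr fC by (simp add: lifted_code_def)
    moreover have "(\<lambda>s\<in>S. restrict g s) = f"
      using f restr by (intro extensionalityI[of _ S]) (auto simp: line_families_def PiE_def)
    ultimately show "f \<in> (\<lambda>g. \<lambda>s\<in>S. restrict g s) ` lifted_code n A S Cs"
      by blast
  qed
qed

lemma bij_betw_lifted_line_code:
  assumes "\<Union>S = {1..n}" "\<And>s. s \<in> S \<Longrightarrow> Cs s \<subseteq> s \<rightarrow>\<^sub>E A" "\<And>s. s \<in> S \<Longrightarrow> inj_on (\<phi> s) (Cs s)"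
  shows "bij_betw (\<lambda>g. \<lambda>s\<in>S. \<phi> s (restrict g s)) (lifted_code n A S Cs) (line_code S Cs \<phi>)"
proof -
  have "inj_on (\<lambda>f. \<lambda>s\<in>S. \<phi> s (f s)) (line_families S Cs)"
  proof (rule inj_onI)
    fix f g
    assume fg: "f \<in> line_families S Cs" "g \<in> line_families S Cs"
      and eq: "(\<lambda>s\<in>S. \<phi> s (f s)) = (\<lambda>s\<in>S. \<phi> s (g s))"
    show "f = g"
    proof (rule PiE_ext)
      show "f \<in> Pi\<^sub>E S Cs" "g \<in> Pi\<^sub>E S Cs"
        using fg by (auto simp: line_families_def)
      then show "f s = g s" if "s \<in> S" for s
        using fun_cong[OF eq, of s] assms(3)[OF that] that by (auto dest: inj_onD)
    qed
  qed
  then have "bij_betw (\<lambda>f. \<lambda>s\<in>S. \<phi> s (f s)) (line_families S Cs) (line_code S Cs \<phi>)"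
    unfolding line_code_def by (rule inj_on_imp_bij_betw)
  from bij_betw_trans[OF bij_betw_lifted_line_families[OF assms(1,2)] this] show ?thesis
    by (simp add: comp_def cong: restrict_cong)
qed

theorem proposition3p6:
  fixes A :: "'a set" and B :: "'b set"
    and n :: nat and S :: "nat set set"
    and Cs :: "nat set \<Rightarrow> (nat \<Rightarrow> 'a) set"
    and \<phi> :: "nat set \<Rightarrow> (nat \<Rightarrow> 'a) \<Rightarrow> 'b"
    and C :: "(nat \<Rightarrow> 'a) set" and L :: "(nat set \<Rightarrow> 'b) set" and \<gamma> :: real
  assumes "finite A" and "card A \<ge> 2"
    and "finite B" and "card B \<ge> 2"
    and "n \<ge> 1"
    and "\<Union>S = {1..n}"
    and "\<And>s. s \<in> S \<Longrightarrow> Cs s \<subseteq> (s \<rightarrow>\<^sub>E A)"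
    and "\<And>s. s \<in> S \<Longrightarrow> card (Cs s) = card B"
    and "\<And>s. s \<in> S \<Longrightarrow> bij_betw (\<phi> s) (Cs s) B"
  defines "C \<equiv> lifted_code n A S Cs"
    and "L \<equiv> line_code S Cs \<phi>"
    and "\<gamma> \<equiv> real (card S) / real n"
  assumes "C \<noteq> {}"
  shows "code_rate {1..n} A C
           = \<gamma> * ln (real (card B)) / ln (real (card A)) * code_rate S B L
       \<and> \<gamma> \<in> {real (D_min n S) / real (k_max S) .. real (D_max n S) / real (k_min S)}
       \<and> ereal (real (D_min n S)) * k_tilde S Cs / ereal (real (D_max n S * k_max S))
             * code_dist S L
           \<le> code_dist {1..n} C
       \<and> code_dist {1..n} C
           \<le> ereal (real (D_max n S * k_max S) / real (D_min n S * k_min S)) * code_dist S L"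
proof -
  let ?\<Phi> = "\<lambda>g. \<lambda>s\<in>S. \<phi> s (restrict g s)"
  define N where "N = real n"
  define m where "m = real (card S)"
  define d where "d = real (D_min n S)"
  define D where "D = real (D_max n S)"
  define k where "k = real (k_min S)"
  define K where "K = real (k_max S)"
  have S_sub: "S \<subseteq> Pow {1..n}"
    using assms(6) by blast
  then have finS: "finite S"
    by (rule finite_subset) simp
  have S_ne: "S \<noteq> {}"
    using assms(5,6) by auto
  have fin: "finite s" if "s \<in> S" for s
    using S_sub that finite_subset[of s "{1..n}"] by blast
  \<comment> \<open>The empty index set carries only one word, whereas every local code has
    \<open>card B\<close> \<ge> 2 words.\<close>
  have ne: "s \<noteq> {}" if s: "s \<in> S" for s
  proof
    assume "s = {}"
    then have "Cs s \<subseteq> {\<lambda>x. undefined}"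
      using assms(7)[OF s] by simp
    then have "card (Cs s) \<le> 1"
      using card_mono[of "{\<lambda>x. undefined}" "Cs s"] by simp
    then show False
      using assms(4) assms(8)[OF s] by simp
  qed
  have kmin_pos: "0 < k"
  proof -
    have "k_min S \<in> card ` S"
      unfolding k_min_def using finS S_ne by (intro Min_in) auto
    then show ?thesis
      using fin ne by (auto simp: k_def card_gt_0_iff)
  qed
  have kmax_pos: "0 < K"
    using S_ne kmin_pos card_bounds[OF finS] by (fastforce simp: k_def K_def)
  have dmin_pos: "0 < d"
  proof -
    have "D_min n S \<in> (\<lambda>i. card {s \<in> S. i \<in> s}) ` {1..n}"
      unfolding D_min_def using assms(5) by (intro Min_in) auto
    then obtain i where i: "i \<in> {1..n}" "D_min n S = card {s \<in> S. i \<in> s}"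
      by blast
    moreover have "{s \<in> S. i \<in> s} \<noteq> {}"
      using i(1) assms(6) by blast
    ultimately show ?thesis
      using finS by (simp add: d_def card_gt_0_iff)
  qed
  have dmax_pos: "0 < D"
    using dmin_pos degree_bounds[of 1 n S] assms(5) by (simp add: d_def D_def)
  have N: "0 < N" and m: "0 < m"
    using assms(5) finS S_ne by (auto simp: N_def m_def card_gt_0_iff)
  \<comment> \<open>This and \<open>gamma_upper\<close> are the two bounds on \<open>m / N\<close>,
    that is on \<gamma>, with denominators cleared.\<close>
  have gamma_lower: "d * N \<le> K * m"
    using D_min_mult_card_le[OF finS fin, of "{1..n}" n S]
    by (simp add: d_def N_def K_def m_def flip: of_nat_mult)
  have gamma_upper: "k * m \<le> D * N"
  proof -
    have "k \<le> real (card (s \<inter> {1..n}))" if "s \<in> S" for s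
      using card_bounds(1)[OF finS that] S_sub that by (auto simp: k_def Int_absorb2)
    from mult_card_le_D_max[OF finS order_refl order_refl this] show ?thesis
      by (simp add: m_def D_def N_def)
  qed

  have bij: "bij_betw ?\<Phi> C L"
    unfolding C_def L_def
    using assms(6,7,9) by (intro bij_betw_lifted_line_code) (auto simp: bij_betw_def)
  have card_L: "card L = card C"
    using bij_betw_same_card[OF bij] by simp
  have "finite ({1..n} \<rightarrow>\<^sub>E A)"
    using assms(1) by (intro finite_PiE) auto
  then have finC: "finite C"
    by (rule rev_finite_subset) (auto simp: C_def lifted_code_def)
  then have finL: "finite L"
    using bij bij_betw_finite by blast

  have local_codes: "finite s \<and> s \<noteq> {} \<and> 2 \<le> card (Cs s)" if "s \<in> S" for s
    using fin[OF that] ne[OF that] assms(4) assms(8)[OF that] by simp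
  obtain q where q: "k_tilde S Cs = ereal q" "0 \<le> q"
    "\<forall>s\<in>S. \<forall>f\<in>Cs s. \<forall>g\<in>Cs s. f \<noteq> g \<longrightarrow> q \<le> real (card {i \<in> s. f i \<noteq> g i})"
    by (rule k_tilde_real[OF finS S_ne local_codes])

  \<comment> \<open>Both distance inequalities are first shown for every pair of words; the minima
    are taken only at the end.\<close>
  have hdist_bounds: "d * q / (D * K) * hdist S (?\<Phi> g) (?\<Phi> h) \<le> hdist {1..n} g h"
      "hdist {1..n} g h \<le> D * K / (d * k) * hdist S (?\<Phi> g) (?\<Phi> h)"
    if g: "g \<in> C" and h: "h \<in> C" for g h
  proof -
    define T where "T = {i \<in> {1..n}. g i \<noteq> h i}"
    define U where "U = {s \<in> S. ?\<Phi> g s \<noteq> ?\<Phi> h s}"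
    define t where "t = real (card T)"
    define u where "u = real (card U)"
    have local_words: "restrict g s \<in> Cs s" "restrict h s \<in> Cs s" if "s \<in> S" for s
      using g h that by (auto simp: C_def lifted_code_def)
    \<comment> \<open>Injectivity of each \<phi> \<open>s\<close> on \<open>Cs s\<close> makes the
      relabelling invisible to the set of differing coordinates.\<close>
    have U_iff: "s \<in> U \<longleftrightarrow> s \<in> S \<and> restrict g s \<noteq> restrict h s" for s
      using assms(9)[of s] local_words[of s] by (auto simp: U_def bij_betw_def dest: inj_onD)
    have "d * t \<le> K * u"
    proof -
      have "s \<in> U" if s: "s \<in> S" "s \<inter> T \<noteq> {}" for s
      proof -
        obtain i where "i \<in> s" "g i \<noteq> h i"
          using s(2) by (auto simp: T_def)
        then have "restrict g s \<noteq> restrict h s"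
          by (metis restrict_apply')
        then show ?thesis
          using U_iff s(1) by blast
      qed
      moreover have "T \<subseteq> {1..n}" "U \<subseteq> S"
        by (auto simp: T_def U_def)
      ultimately have "D_min n S * card T \<le> k_max S * card U"
        using finS fin by (intro D_min_mult_card_le)
      then show ?thesis
        by (simp add: d_def t_def K_def u_def flip: of_nat_mult)
    qed
    have "q * u \<le> D * t"
      unfolding u_def D_def t_def
    proof (rule mult_card_le_D_max[OF finS])
      fix s assume "s \<in> U"
      then have s: "s \<in> S" "restrict g s \<noteq> restrict h s"
        using U_iff by blast+
      have "{i \<in> s. restrict g s i \<noteq> restrict h s i} = s \<inter> T"
        using s(1) assms(6) by (auto simp: T_def)
      then show "q \<le> real (card (s \<inter> T))"
        using q(3) s local_words[OF s(1)] by metis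
    qed (auto simp: T_def U_def)
    have hC: "hdist {1..n} g h = t / N"
      by (simp add: hdist_def T_def t_def N_def)
    have hL: "hdist S (?\<Phi> g) (?\<Phi> h) = u / m"
      by (simp add: hdist_def U_def u_def m_def)
    have "0 \<le> t" "0 \<le> u"
      by (simp_all add: t_def u_def)
    \<comment> \<open>Product of the bound on \<gamma> and the bound on \<open>u\<close>; dividing
      by \<open>D * K * N * m\<close> gives the claim about normalised distances.\<close>
    have "(d * N) * (q * u) \<le> (K * m) * (D * t)"
      using \<open>0 \<le> q\<close> \<open>0 \<le> u\<close> kmax_pos m
      by (intro mult_mono[OF gamma_lower \<open>q * u \<le> D * t\<close>]) auto
    then show "d * q / (D * K) * hdist S (?\<Phi> g) (?\<Phi> h) \<le> hdist {1..n} g h"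
      unfolding hC hL using N m kmax_pos dmax_pos by (simp add: field_simps)
    \<comment> \<open>Likewise with the other two bounds, dividing by
      \<open>d * k * N * m\<close>.\<close>
    have "(d * t) * (k * m) \<le> (K * u) * (D * N)"
      using \<open>0 \<le> u\<close> kmax_pos kmin_pos m
      by (intro mult_mono[OF \<open>d * t \<le> K * u\<close> gamma_upper]) auto
    then show "hdist {1..n} g h \<le> D * K / (d * k) * hdist S (?\<Phi> g) (?\<Phi> h)"
      unfolding hC hL using N m kmin_pos dmin_pos by (simp add: field_simps)
  qed

  \<comment> \<open>Both rates have numerator \<open>ln (real (card C))\<close>, since the codes are
    equinumerous; their denominators are \<open>N * ln (real (card A))\<close> and
    \<open>m * ln (real (card B))\<close>.\<close>
  have "code_rate {1..n} A C = \<gamma> * ln (real (card B)) / ln (real (card A)) * code_rate S B L"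
  proof -
    have "0 < ln (real (card A))" "0 < ln (real (card B))"
      using assms(2,4) by simp_all
    moreover have "code_rate {1..n} A C = ln (real (card C)) / (N * ln (real (card A)))"
      using assms(2) by (simp add: code_rate_def card_PiE log_def N_def ln_realpow)
    moreover have "code_rate S B L = ln (real (card C)) / (m * ln (real (card B)))"
      using assms(4) finS by (simp add: code_rate_def card_PiE log_def m_def ln_realpow card_L)
    moreover have "\<gamma> = m / N"
      by (simp add: \<gamma>_def m_def N_def)
    ultimately show ?thesis
      using N m by simp
  qed
  moreover have "\<gamma> \<in> {d / K .. D / k}"
    using gamma_lower gamma_upper N kmax_pos kmin_pos
    by (auto simp: \<gamma>_def field_simps simp flip: m_def N_def)
  moreover have
    "ereal d * k_tilde S Cs / ereal (D * K) * code_dist S L \<le> code_dist {1..n} C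
     \<and> code_dist {1..n} C \<le> ereal (D * K / (d * k)) * code_dist S L"
  proof (cases "card C = 1")
    \<comment> \<open>Both distances are infinite. The upper bound survives because its constant is
      positive, so its right-hand side is infinite too.\<close>
    case True
    then have "code_dist {1..n} C = \<infinity>" "code_dist S L = \<infinity>"
      using card_L by (simp_all add: code_dist_def)
    then show ?thesis
      using kmax_pos kmin_pos dmax_pos dmin_pos by simp
  next
    case False
    moreover have "card C \<noteq> 0"
      using finC assms(13) by simp
    ultimately have card_C: "2 \<le> card C"
      by linarith
    have inj: "inj_on ?\<Phi> C" and img: "?\<Phi> ` C = L"
      using bij by (auto simp: bij_betw_def)
    have coeff: "ereal d * k_tilde S Cs / ereal (D * K) = ereal (d * q / (D * K))"
      using kmax_pos dmax_pos by (simp add: q(1))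
    \<comment> \<open>Lower bound: a closest pair in \<open>C\<close> maps to a pair of distinct
      words of \<open>L\<close>, whose distance is at least the minimum there.\<close>
    obtain g h where gh: "g \<in> C" "h \<in> C" "g \<noteq> h" "code_dist {1..n} C = ereal (hdist {1..n} g h)"
      using code_dist_attained[OF card_C] .
    have "code_dist S L \<le> ereal (hdist S (?\<Phi> g) (?\<Phi> h))"
    proof (rule code_dist_le[OF finL])
      show "?\<Phi> g \<in> L" "?\<Phi> h \<in> L"
        using gh(1,2) img by blast+
      show "?\<Phi> g \<noteq> ?\<Phi> h"
        using inj_onD[OF inj _ gh(1,2)] gh(3) by blast
    qed
    then have "ereal (d * q / (D * K)) * code_dist S L
        \<le> ereal (d * q / (D * K)) * ereal (hdist S (?\<Phi> g) (?\<Phi> h))"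
      using q(2) dmin_pos dmax_pos kmax_pos by (intro ereal_mult_left_mono) auto
    also have "\<dots> \<le> code_dist {1..n} C"
      using hdist_bounds(1)[OF gh(1,2)] unfolding gh(4) by simp
    finally have lower: "ereal (d * q / (D * K)) * code_dist S L \<le> code_dist {1..n} C" .
    \<comment> \<open>Upper bound: a closest pair in \<open>L\<close> is pulled back to distinct
      words of \<open>C\<close> by surjectivity.\<close>
    obtain v w where vw: "v \<in> L" "w \<in> L" "v \<noteq> w" "code_dist S L = ereal (hdist S v w)"
      using code_dist_attained[OF card_C[folded card_L]] .
    obtain g' h' where g'h': "g' \<in> C" "h' \<in> C" "v = ?\<Phi> g'" "w = ?\<Phi> h'"
      using vw(1,2) img by blast
    then have "g' \<noteq> h'"
      using vw(3) by blast
    then have "code_dist {1..n} C \<le> ereal (hdist {1..n} g' h')"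
      using code_dist_le[OF finC g'h'(1,2)] by blast
    also have "\<dots> \<le> ereal (D * K / (d * k)) * code_dist S L"
      using hdist_bounds(2)[OF g'h'(1,2)] by (simp add: vw(4) g'h'(3,4))
    finally show ?thesis
      using lower coeff by simp
  qed
  ultimately show ?thesis
    by (simp add: d_def D_def k_def K_def)
qed

end
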